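(* Let $\mathbb{Y}$ be an $m$-dimensional subspace of $\ell_\infty$ and let $\mathcal{A}=\{\widetilde{a_1},\ldots,\widetilde{a_m}\}$ be a basis of $\mathbb{Y}$. If $\mathbb{Y}$ is polyhedral, then the number of nonequivalent components of $\mathcal{A}$ satisfying the $*$-Property is finite.
   Context: All spaces are over $\mathbb{R}$; $\ell_\infty$ is the space of bounded real sequences with the supremum norm. A finite-dimensional Banach space is polyhedral if its closed unit ball has only finitely many extreme points. Let $\mathcal{A}=\{\widetilde{a_1},\ldots,\widetilde{a_m}\}\subset\ell_\infty$ be linearly independent, $\widetilde{a_k}=(a_1^k,a_2^k,\ldots)$. Put $\mathcal{S}=\{(a_i^1,a_i^2,\ldots,a_i^m)\in\mathbb{R}^m: i\in\mathbb{N}\}$ and let $\overline{\mathcal{S}}$ be its closure in the Euclidean topology of $\mathbb{R}^m$. Elements of $\overline{\mathcal{S}}$ are called components of $\mathcal{A}$. Two components $\mathbf{a},\mathbf{b}\in\overline{\mathcal{S}}$ are equivalent if $\mathbf{a}=\pm\mathbf{b}$, and $E_{\mathbf{a}}=\{\mathbf{b}\in\overline{\mathcal{S}}:\mathbf{b}=\pm\mathbf{a}\}$. A component $\mathbf{a}=(\widehat{a}_1,\ldots,\widehat{a}_m)\in\overline{\mathcal{S}}$ satisfies the $*$-Property if there is $(\beta_1,\ldots,\beta_m)\in\mathbb{R}^m$ such that $|\sum_{k=1}^m\beta_k\widehat{a}_k|>|\sum_{k=1}^m\beta_k\widehat{b}_k|$ for all $\mathbf{b}=(\widehat{b}_1,\ldots,\widehat{b}_m)\in\overline{\mathcal{S}}\setminus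 E_{\mathbf{a}}$. "The number of nonequivalent components satisfying the $*$-Property" is the number of equivalence classes of components satisfying it. *)

theory Defs
  imports "HOL-Analysis.Analysis"
begin

text \<open>Since the topology of \<^typ>\<open>nat\<close> is discrete, every bounded sequence is continuous, so
  bounded continuous functions on \<^typ>\<open>nat\<close> with the supremum norm are exactly the space of
  bounded real sequences.\<close>

type_synonym ell_infty = "nat \<Rightarrow>\<^sub>C real"

text \<open>\<^term>\<open>cball 0 1 \<inter> Y\<close> is the closed unit ball of the normed space \<open>Y\<close>. A finite-dimensional
  subspace is automatically complete.\<close>

definition polyhedral :: "'a::real_normed_vector set \<Rightarrow> bool" where
  "polyhedral Y \<longleftrightarrow> subspace Y \<and> (\<exists>B. finite B \<and> span B = Y) \<and>
     finite {x. x extreme_point_of (cball 0 1 \<inter> Y)}"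

text \<open>A finite tuple of sequences is a family \<open>a\<close> indexed by a finite type \<open>'m\<close>, so that
  \<open>m = CARD('m)\<close>.\<close>

definition basis_components :: "('m::finite \<Rightarrow> ell_infty) \<Rightarrow> (real ^ 'm) set" where
  "basis_components a = closure (range (\<lambda>i. \<chi> k. apply_bcontfun (a k) i))"

definition component_class :: "('m::finite \<Rightarrow> ell_infty) \<Rightarrow> real ^ 'm \<Rightarrow> (real ^ 'm) set" where
  "component_class a x = {y \<in> basis_components a. y = x \<or> y = - x}"

definition star_property :: "('m::finite \<Rightarrow> ell_infty) \<Rightarrow> real ^ 'm \<Rightarrow> bool" where
  "star_property a x \<longleftrightarrow> (\<exists>\<beta> :: real ^ 'm. \<forall>y \<in> basis_components a - component_class a x.
     \<bar>\<Sum>k\<in>UNIV. \<beta> $ k * x $ k\<bar> > \<bar>\<Sum>k\<in>UNIV. \<beta> $ k * y $ k\<bar>)"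

end

theory Submission
  imports Defs
begin

text \<open>
  Identify \<open>\<beta> \<in> \<real>\<^sup>m\<close> with the vector \<open>\<Sum>k. \<beta>\<^sub>k a\<^sub>k\<close> of \<open>Y\<close>. Its supremum norm is the supremum of
  \<open>\<bar>\<beta> \<bullet> y\<bar>\<close> over the components \<open>y\<close> (\<open>norm_lincomb_le_iff\<close>), so every component acts on \<open>Y\<close>
  as a linear functional of norm at most one. In these coordinates the unit ball of \<open>Y\<close> is a
  compact convex subset of \<open>\<real>\<^sup>m\<close>. By polyhedrality and the Krein-Milman theorem it is the convex
  hull of a finite set \<open>V\<close> (\<open>polyhedral_coefficient_ball\<close>).

  Attach to each component \<open>x\<close> its contact set \<open>{v \<in> V. v \<bullet> x = 1}\<close>, one of the finitely many
  subsets of \<open>V\<close>. If \<open>x\<close> has the star property, witnessed by \<open>\<beta>\<close>, then the contact set determines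
  the class of \<open>x\<close> (\<open>component_class_eq_if_contact_set_eq\<close>). If \<open>\<beta> \<bullet> x = 0\<close>,
  then every component is \<open>\<plusminus>x\<close>. Otherwise scale \<open>\<beta>\<close> so that \<open>\<beta> \<bullet> x = 1\<close>. As \<open>\<bar>\<beta> \<bullet> y\<bar>\<close> is largest
  at \<open>y = x\<close>, the vector \<open>\<beta>\<close> lies in the unit ball, and so it is a convex combination of points
  of \<open>V\<close>. Since \<open>v \<bullet> x \<le> 1\<close> on \<open>V\<close>, only points of the
  contact set of \<open>x\<close> carry weight in it. A component \<open>y\<close> with the same contact set
  therefore satisfies \<open>\<beta> \<bullet> y = 1\<close> too (\<open>inner_eq_one_on_contact_set\<close>), and the star property
  forces \<open>y = \<plusminus>x\<close>.
\<close>

text \<open>A convex combination of numbers \<open>v \<bullet> x \<le> 1\<close> equals one only if all weight sits where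
  \<open>v \<bullet> x = 1\<close>; there \<open>v \<bullet> y = 1\<close> as well.\<close>

lemma inner_eq_one_on_contact_set:
  fixes \<beta> x y :: "'a::real_inner"
  assumes "finite V" "\<beta> \<in> convex hull V" "\<beta> \<bullet> x = 1" "\<And>v. v \<in> V \<Longrightarrow> v \<bullet> x \<le> 1"
    and "\<And>v. v \<in> V \<Longrightarrow> v \<bullet> x = 1 \<Longrightarrow> v \<bullet> y = 1"
  shows "\<beta> \<bullet> y = 1"
proof -
  obtain u where u: "\<And>v. v \<in> V \<Longrightarrow> 0 \<le> u v" "sum u V = 1" "(\<Sum>v\<in>V. u v *\<^sub>R v) = \<beta>"
    using assms(1,2) by (auto simp: convex_hull_finite)
  have slack: "1 - \<beta> \<bullet> z = (\<Sum>v\<in>V. u v * (1 - v \<bullet> z))" for z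
    by (simp add: u(2) flip: u(3))
      (simp add: inner_sum_left right_diff_distrib sum_subtractf u(2))
  have "(\<Sum>v\<in>V. u v * (1 - v \<bullet> x)) = 0"
    using slack[of x] assms(3) by simp
  then have "\<forall>v\<in>V. u v * (1 - v \<bullet> x) = 0"
    using assms(1,4) u(1) by (subst (asm) sum_nonneg_eq_0_iff) auto
  then have "\<forall>v\<in>V. u v * (1 - v \<bullet> y) = 0"
    using assms(5) by force
  then have "(\<Sum>v\<in>V. u v * (1 - v \<bullet> y)) = 0" by (intro sum.neutral)
  then show ?thesis using slack[of y] by simp
qed

text \<open>Closedness is continuity of \<open>T\<close>. Boundedness holds because \<open>norm (T x)\<close> is positive on the
  unit sphere and attains its minimum \<open>c > 0\<close> there, so that \<open>c * norm x \<le> norm (T x)\<close>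
  everywhere.\<close>

lemma linear_inj_vimage_cball_compact:
  fixes T :: "'a::euclidean_space \<Rightarrow> 'b::real_normed_vector"
  assumes "linear T" "inj T"
  shows "compact (T -` cball 0 r)"
proof -
  have cont: "continuous_on A T" for A
    using assms(1) by (simp add: linear_conv_bounded_linear linear_continuous_on)
  have "closed (T -` cball 0 r)"
    using cont[of UNIV] by (simp add: closed_vimage)
  moreover have "bounded (T -` cball 0 r)"
  proof -
    have "\<exists>c>0. \<forall>x\<in>sphere 0 1. c \<le> norm (T x)"
      \<comment> \<open>The sphere is empty when \<open>'a\<close> is zero-dimensional.\<close>
    proof (cases "sphere (0::'a) 1 = {}")
      case False
      have "compact (sphere (0::'a) 1)" by simp
      from continuous_attains_inf[OF this False continuous_on_norm[OF cont]]
      obtain x where x: "x \<in> sphere 0 1" "\<forall>y\<in>sphere 0 1. norm (T x) \<le> norm (T y)"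
        by blast
      have "T x \<noteq> 0"
        using x(1) assms by (metis linear_0 injD mem_sphere_0 norm_zero zero_neq_one)
      then show ?thesis using x(2) by (intro exI[of _ "norm (T x)"]) auto
    qed (auto intro: exI[of _ 1])
    then obtain c where c: "c > 0" "\<And>x. norm x = 1 \<Longrightarrow> c \<le> norm (T x)" by auto
    have "norm x \<le> r / c" if "norm (T x) \<le> r" for x
    proof (cases "x = 0")
      case True then show ?thesis using that c(1) assms(1) by (simp add: linear_0)
    next
      case False
      have "c \<le> norm (T ((1 / norm x) *\<^sub>R x))" using False by (intro c(2)) simp
      also have "\<dots> = norm (T x) / norm x" by (simp add: linear_scale[OF assms(1)])
      finally show ?thesis using that c(1) False by (simp add: field_simps)
    qed
    then show ?thesis by (intro boundedI[of _ "r / c"]) simp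
  qed
  ultimately show ?thesis by (simp add: compact_eq_bounded_closed)
qed

definition lincomb :: "('m::finite \<Rightarrow> ell_infty) \<Rightarrow> real ^ 'm \<Rightarrow> ell_infty" where
  "lincomb a \<beta> = (\<Sum>k\<in>UNIV. (\<beta> $ k) *\<^sub>R a k)"

lemma linear_lincomb: "linear (lincomb a)"
  by (rule linearI) (simp_all add: lincomb_def scaleR_add_left sum.distrib scaleR_sum_right)

lemma inj_lincomb:
  assumes "inj a" "independent (range a)"
  shows "inj (lincomb a)"
proof (subst linear_injective_0[OF linear_lincomb], intro allI impI)
  fix \<beta> assume "lincomb a \<beta> = 0"
  then have "(\<Sum>v\<in>range a. (\<beta> $ inv a v) *\<^sub>R v) = 0"
    using assms(1) by (simp add: sum.reindex lincomb_def)
  then have "\<beta> $ inv a (a k) = 0" for k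
    using independentD[OF assms(2), of "range a" "\<lambda>v. \<beta> $ inv a v" "a k"] by simp
  then show "\<beta> = 0" using assms(1) by (simp add: vec_eq_iff)
qed

lemma range_lincomb:
  assumes "inj a"
  shows "range (lincomb a) = span (range a)"
proof
  show "range (lincomb a) \<subseteq> span (range a)"
    by (auto simp: lincomb_def intro!: span_sum span_scale intro: span_base)
  have "(\<Sum>v\<in>range a. u v *\<^sub>R v) = lincomb a (\<chi> k. u (a k))" for u
    using assms by (simp add: lincomb_def sum.reindex)
  then show "span (range a) \<subseteq> range (lincomb a)"
    by (auto simp: span_finite)
qed

lemma apply_lincomb: "apply_bcontfun (lincomb a \<beta>) i = \<beta> \<bullet> (\<chi> k. apply_bcontfun (a k) i)"
proof -
  have "apply_bcontfun (\<Sum>k\<in>A. (\<beta> $ k) *\<^sub>R a k) i = (\<Sum>k\<in>A. \<beta> $ k * apply_bcontfun (a k) i)"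
    if "finite A" for A
    using that by induction auto
  then show ?thesis by (simp add: lincomb_def inner_vec_def)
qed

text \<open>The rows of the family compute the entries of \<open>lincomb a \<beta>\<close>. Passing from the rows to their
  closure changes nothing, since \<open>\<bar>\<beta> \<bullet> y\<bar> \<le> r\<close> is a closed condition on \<open>y\<close>.\<close>

lemma norm_lincomb_le_iff:
  "norm (lincomb a \<beta>) \<le> r \<longleftrightarrow> (\<forall>y\<in>basis_components a. \<bar>\<beta> \<bullet> y\<bar> \<le> r)"
proof
  assume le: "norm (lincomb a \<beta>) \<le> r"
  have "range (\<lambda>i. \<chi> k. apply_bcontfun (a k) i) \<subseteq> {y. \<bar>\<beta> \<bullet> y\<bar> \<le> r}"
    using order_trans[OF norm_bounded le] by (auto simp: apply_lincomb)
  moreover have "closed {y. \<bar>\<beta> \<bullet> y\<bar> \<le> r}"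
    by (intro closed_Collect_le continuous_intros)
  ultimately show "\<forall>y\<in>basis_components a. \<bar>\<beta> \<bullet> y\<bar> \<le> r"
    unfolding basis_components_def using closure_minimal by blast
next
  assume le: "\<forall>y\<in>basis_components a. \<bar>\<beta> \<bullet> y\<bar> \<le> r"
  have "(\<chi> k. apply_bcontfun (a k) i) \<in> basis_components a" for i
    unfolding basis_components_def by (rule closure_subset[THEN subsetD, OF rangeI])
  then show "norm (lincomb a \<beta>) \<le> r"
    using le by (intro norm_bound) (simp add: apply_lincomb)
qed

lemma extreme_points_of_inj_linear_vimage:
  assumes "linear f" "inj f"
  shows "f ` {x. x extreme_point_of (f -` S)} = {y. y extreme_point_of (S \<inter> range f)}"
proof -
  have iff: "f x extreme_point_of (S \<inter> range f) \<longleftrightarrow> x extreme_point_of (f -` S)" for x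
  proof -
    have "f ` (f -` S) = S \<inter> range f" by auto
    then show ?thesis
      using face_of_linear_image[OF assms, of "{x}" "f -` S"]
      by (simp add: face_of_singleton)
  qed
  have "y \<in> range f" if "y extreme_point_of (S \<inter> range f)" for y
    using that by (simp add: extreme_point_of_def)
  then show ?thesis using iff by blast
qed

text \<open>The Krein-Milman theorem is applied in the Euclidean space of coefficients. The coordinate
  map is an injective linear map onto the span, so it matches the extreme points of the two
  unit balls.\<close>

lemma polyhedral_coefficient_ball:
  assumes "inj a" "independent (range a)" "polyhedral (span (range a))"
  obtains V where "finite V" "convex hull V = lincomb a -` cball 0 1"
proof -
  let ?B = "lincomb a -` cball 0 1" and ?V = "{v. v extreme_point_of (lincomb a -` cball 0 1)}"
  have inj: "inj (lincomb a)" using assms(1,2) by (rule inj_lincomb)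
  have "lincomb a ` ?V = {y. y extreme_point_of (cball 0 1 \<inter> span (range a))}"
    using extreme_points_of_inj_linear_vimage[OF linear_lincomb inj] assms(1)
    by (simp add: range_lincomb)
  then have "finite (lincomb a ` ?V)"
    using assms(3) by (simp add: polyhedral_def)
  then have "finite ?V" using inj by (metis finite_imageD inj_on_subset subset_UNIV)
  moreover have "convex hull ?V = ?B"
    by (intro Krein_Milman_Minkowski[symmetric] linear_inj_vimage_cball_compact linear_lincomb inj
        convex_linear_vimage convex_cball)
  ultimately show ?thesis by (rule that)
qed

lemma component_class_eqI:
  assumes "y \<in> component_class a x"
  shows "component_class a y = component_class a x"
  using assms by (auto simp: component_class_def)

text \<open>The star property makes \<open>x\<close>, up to sign, the only component at which \<open>\<bar>\<beta> \<bullet> y\<bar>\<close> is maximal,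
  while the contact set of \<open>x\<close> already determines the points where the normalised \<open>\<beta>\<close> takes its
  maximum.\<close>

lemma component_class_eq_if_contact_set_eq:
  assumes V: "finite V" "convex hull V = lincomb a -` cball 0 1"
    and x: "x \<in> basis_components a" "star_property a x"
    and y: "y \<in> basis_components a"
    and eq: "{v \<in> V. v \<bullet> x = 1} = {v \<in> V. v \<bullet> y = 1}"
  shows "component_class a x = component_class a y"
proof -
  obtain \<beta> where \<beta>: "\<And>z. z \<in> basis_components a \<Longrightarrow> z \<notin> component_class a x \<Longrightarrow> \<bar>\<beta> \<bullet> z\<bar> < \<bar>\<beta> \<bullet> x\<bar>"
    using x(2) by (auto simp: star_property_def inner_vec_def)
  have "y \<in> component_class a x"
  proof (cases "\<beta> \<bullet> x = 0")
    case True
    \<comment> \<open>No absolute value is strictly below \<open>\<bar>\<beta> \<bullet> x\<bar> = 0\<close>.\<close>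
    then show ?thesis using \<beta>[OF y] by fastforce
  next
    case False
    define \<gamma> where "\<gamma> = (1 / (\<beta> \<bullet> x)) *\<^sub>R \<beta>"
    have \<gamma>x: "\<gamma> \<bullet> x = 1" using False by (simp add: \<gamma>_def)
    have \<gamma>less: "\<bar>\<gamma> \<bullet> z\<bar> < 1" if "z \<in> basis_components a" "z \<notin> component_class a x" for z
      using \<beta>[OF that] False by (simp add: \<gamma>_def)
    have "\<bar>\<gamma> \<bullet> z\<bar> \<le> 1" if "z \<in> basis_components a" for z
      using \<gamma>less[OF that] \<gamma>x by (cases "z \<in> component_class a x") (auto simp: component_class_def)
    then have "\<gamma> \<in> convex hull V"
      by (simp add: V(2) norm_lincomb_le_iff)
    moreover have "v \<bullet> x \<le> 1" if "v \<in> V" for v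
    proof -
      have "norm (lincomb a v) \<le> 1"
        using hull_inc[OF that, of convex] by (simp add: V(2))
      then show ?thesis using x(1) by (fastforce simp: norm_lincomb_le_iff)
    qed
    moreover have "v \<bullet> y = 1" if "v \<in> V" "v \<bullet> x = 1" for v
      using eq that by auto
    ultimately have "\<gamma> \<bullet> y = 1"
      using inner_eq_one_on_contact_set[OF V(1) _ \<gamma>x] by blast
    then show ?thesis using \<gamma>less[OF y] by fastforce
  qed
  then show ?thesis by (rule component_class_eqI[symmetric])
qed

theorem theorem2p9:
  fixes Y :: "ell_infty set"
    and a :: "'m::finite \<Rightarrow> ell_infty"
  assumes "subspace Y"
    and "dim Y = CARD('m)"
    and "inj a"
    and "independent (range a)"
    and "span (range a) = Y"
    and "polyhedral Y"
  shows "finite {component_class a x | x. x \<in> basis_components a \<and> star_property a x}"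
proof -
  obtain V where V: "finite V" "convex hull V = lincomb a -` cball 0 1"
    using polyhedral_coefficient_ball assms(3-6) by metis
  define contact where "contact x = {v \<in> V. v \<bullet> x = 1}" for x
  let ?X = "{x \<in> basis_components a. star_property a x}"
  \<comment> \<open>The class is a function of the contact set: compute it at any chosen component with the star
      property that has this contact set.\<close>
  have "component_class a x = component_class a (inv_into ?X contact (contact x))"
    if "x \<in> ?X" for x
  proof (rule component_class_eq_if_contact_set_eq[OF V])
    have "contact x \<in> contact ` ?X" using that by blast
    from inv_into_into[OF this] f_inv_into_f[OF this]
    show "inv_into ?X contact (contact x) \<in> basis_components a"
      and "{v \<in> V. v \<bullet> x = 1} = {v \<in> V. v \<bullet> inv_into ?X contact (contact x) = 1}"
      unfolding contact_def by auto
  qed (use that in auto)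
  then have "component_class a ` ?X \<subseteq> (\<lambda>F. component_class a (inv_into ?X contact F)) ` Pow V"
    by (force simp: contact_def)
  then have "finite (component_class a ` ?X)"
    using V(1) by (meson finite_Pow_iff finite_imageI finite_subset)
  moreover have "{component_class a x | x. x \<in> basis_components a \<and> star_property a x}
      = component_class a ` ?X" by blast
  ultimately show ?thesis by simp
qed

end
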